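(* Let $H(p)=-p\log_2(p)-(1-p)\log_2(1-p)$ be the binary entropy function, let $p_*$ be the unique solution of the equation $H(p)=1-2p$ subject to $p<1/2$, and let $0<p_0<p_*$. Then $\mathrm{GMN}(P_n)\le\lceil(1-p_0)\cdot n\rceil$ holds for all but finitely many positive integers $n$.
   Context: $P_n$ denotes the powerset class: the concept class of all $2^n$ functions $c:X\to\{0,1\}$ over a domain $X=\{x_1,\ldots,x_n\}$ of size $n$. For a finite set $X$ and a nonempty family (concept class) $C$ of functions $c:X\to\{0,1\}$ (concepts): a labeled sample of size $m\ge 0$ is a set $S=\{(x_1,b_1),\ldots,(x_m,b_m)\}\subseteq X\times\{0,1\}$ with $x_1,\ldots,x_m$ distinct; $|S|=m$ (the empty sample is allowed). A concept $c$ is consistent with $S$ if $c(x_i)=b_i$ for all $i$. A $C$-saturating matching is a map $M$ assigning to each $c\in C$ a labeled sample $M(c)$ with which $c$ is consistent, such that $M(c)\ne M(c')$ whenever $c\neq c'$ in $C$. Its cost is $\max_{c\in C}|M(c)|$. A $C$-saturating matching $M'$ is a direct improvement of a $C$-saturating matching $M$ if $M'$ differs from $M$ only on a single concept $c$ and $|M'(c)|<|M(c)|$. $M$ is greedy if it admits no direct improvement. $\mathrm{GMN}(C)$ is the largest cost of a greedy $C$-saturating matching. *)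

theory Defs
  imports Complex_Main "HOL-Library.FuncSet"
begin

text \<open>
  Labels 0, 1 are the booleans. A concept over \<open>X\<close> is an extensional function on \<open>X\<close>
  (\<open>undefined\<close> outside \<open>X\<close>), so that distinct members of a class differ at a point of \<open>X\<close>.
\<close>

type_synonym 'a concept = "'a \<Rightarrow> bool"

type_synonym 'a sample = "('a \<times> bool) set"

definition powerset_class :: "'a set \<Rightarrow> 'a concept set" where
  "powerset_class X = X \<rightarrow>\<^sub>E UNIV"

text \<open>Injectivity of \<open>fst\<close> says that the instances occurring in a sample are distinct.\<close>

definition labeled_sample :: "'a set \<Rightarrow> 'a sample \<Rightarrow> bool" where
  "labeled_sample X S \<longleftrightarrow> finite S \<and> S \<subseteq> X \<times> UNIV \<and> inj_on fst S"

definition consistent :: "'a concept \<Rightarrow> 'a sample \<Rightarrow> bool" where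
  "consistent c S \<longleftrightarrow> (\<forall>(x, b) \<in> S. c x = b)"

text \<open>A matching is a total function, of which only the values on \<open>C\<close> matter.\<close>

definition saturating_matching ::
  "'a set \<Rightarrow> 'a concept set \<Rightarrow> ('a concept \<Rightarrow> 'a sample) \<Rightarrow> bool" where
  "saturating_matching X C M \<longleftrightarrow>
     (\<forall>c\<in>C. labeled_sample X (M c) \<and> consistent c (M c)) \<and> inj_on M C"

definition cost :: "'a concept set \<Rightarrow> ('a concept \<Rightarrow> 'a sample) \<Rightarrow> nat" where
  "cost C M = Max ((\<lambda>c. card (M c)) ` C)"

definition direct_improvement ::
  "'a set \<Rightarrow> 'a concept set \<Rightarrow> ('a concept \<Rightarrow> 'a sample) \<Rightarrow> ('a concept \<Rightarrow> 'a sample) \<Rightarrow> bool"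
where
  "direct_improvement X C M M' \<longleftrightarrow>
     saturating_matching X C M \<and> saturating_matching X C M' \<and>
     (\<exists>c\<in>C. (\<forall>c'\<in>C - {c}. M' c' = M c') \<and> card (M' c) < card (M c))"

definition greedy_matching ::
  "'a set \<Rightarrow> 'a concept set \<Rightarrow> ('a concept \<Rightarrow> 'a sample) \<Rightarrow> bool" where
  "greedy_matching X C M \<longleftrightarrow>
     saturating_matching X C M \<and> (\<nexists>M'. direct_improvement X C M M')"

definition GMN :: "'a set \<Rightarrow> 'a concept set \<Rightarrow> nat" where
  "GMN X C = Max {cost C M | M. greedy_matching X C M}"

lemma saturating_matching_card_le:
  assumes "finite X" "saturating_matching X C M" "c \<in> C"
  shows "card (M c) \<le> card X"
proof -
  have "labeled_sample X (M c)"
    using assms by (auto simp: saturating_matching_def)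
  then have "inj_on fst (M c)" "fst ` M c \<subseteq> X"
    by (auto simp: labeled_sample_def)
  then show ?thesis using assms(1) by (metis card_image card_mono)
qed

text \<open>The maximum defining \<open>GMN\<close> is over a finite nonempty set.\<close>

lemma finite_greedy_costs:
  assumes "finite X" "finite C" "C \<noteq> {}"
  shows "finite {cost C M | M. greedy_matching X C M}"
proof (rule finite_subset[of _ "{..card X}"])
  show "{cost C M | M. greedy_matching X C M} \<subseteq> {..card X}"
  proof
    fix k assume "k \<in> {cost C M | M. greedy_matching X C M}"
    then obtain M where "k = cost C M" "saturating_matching X C M"
      by (auto simp: greedy_matching_def)
    then show "k \<in> {..card X}"
      using assms saturating_matching_card_le[OF assms(1)] by (simp add: cost_def)
  qed
qed simp

lemma greedy_matching_exists:
  assumes "finite X" "finite C" "C \<subseteq> X \<rightarrow>\<^sub>E UNIV"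
  shows "\<exists>M. greedy_matching X C M"
proof -
  define M0 :: "'a concept \<Rightarrow> 'a sample" where "M0 = (\<lambda>c. (\<lambda>x. (x, c x)) ` X)"
  have "inj_on M0 C"
  proof (rule inj_onI)
    fix c d assume cd: "c \<in> C" "d \<in> C" "M0 c = M0 d"
    have "c x = d x" if "x \<in> X" for x
      using cd(3) that by (auto simp: M0_def)
    then show "c = d"
      using cd(1,2) assms(3) by (intro PiE_ext[of c X "\<lambda>_. UNIV" d]) auto
  qed
  then have M0: "saturating_matching X C M0"
    using assms(1) unfolding saturating_matching_def
    by (simp add: M0_def labeled_sample_def consistent_def inj_on_def image_subset_iff)
  define M where "M = arg_min (\<lambda>M. \<Sum>c\<in>C. card (M c)) (saturating_matching X C)"
  note min = arg_min_nat_lemma[of "saturating_matching X C" M0 "\<lambda>M. \<Sum>c\<in>C. card (M c)", OF M0,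
      folded M_def]
  have M: "saturating_matching X C M" using min by (rule conjunct1)
  have least: "(\<Sum>c\<in>C. card (M c)) \<le> (\<Sum>c\<in>C. card (M' c))"
    if "saturating_matching X C M'" for M'
    using conjunct2[OF min, rule_format, OF that] .
  have "\<not> direct_improvement X C M M'" for M'
  proof
    assume *: "direct_improvement X C M M'"
    then obtain c where c: "c \<in> C" "\<forall>c'\<in>C - {c}. M' c' = M c'" "card (M' c) < card (M c)"
      by (auto simp: direct_improvement_def)
    have "(\<Sum>c\<in>C. card (M' c)) < (\<Sum>c\<in>C. card (M c))"
    proof (rule sum_strict_mono_ex1[OF assms(2)])
      show "\<forall>c'\<in>C. card (M' c') \<le> card (M c')"
      proof
        fix c' assume "c' \<in> C"
        then show "card (M' c') \<le> card (M c')"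
          using c by (cases "c' = c") auto
      qed
      show "\<exists>c'\<in>C. card (M' c') < card (M c')" using c by blast
    qed
    moreover have "saturating_matching X C M'"
      using * by (simp add: direct_improvement_def)
    ultimately show False using least[of M'] by simp
  qed
  with M show ?thesis unfolding greedy_matching_def by blast
qed

text \<open>
  The convention \<open>0 log 0 = 0\<close> at the endpoints of \<open>[0, 1]\<close> holds because \<open>log 2\<close> is total.
\<close>

definition binary_entropy :: "real \<Rightarrow> real" where
  "binary_entropy p = - p * log 2 p - (1 - p) * log 2 (1 - p)"

text \<open>
  The entropy function is only meaningful on \<open>[0, 1]\<close>; hence the explicit lower bound.
\<close>

definition p_star :: real where
  "p_star = (THE p. 0 \<le> p \<and> p < 1/2 \<and> binary_entropy p = 1 - 2 * p)"

lemma p_star_ex1: "\<exists>!p. 0 \<le> p \<and> p < 1/2 \<and> binary_entropy p = 1 - 2 * p"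
proof -
  define f where "f = (\<lambda>p. binary_entropy p + 2 * p)"
  have deriv: "(f has_real_derivative log 2 (1 - p) - log 2 p + 2) (at p)"
    if "0 < p" "p < 1" for p
  proof -
    have "((\<lambda>p. - p * (ln p / ln 2) - (1 - p) * (ln (1 - p) / ln 2) + 2 * p)
            has_real_derivative
            - (ln p / ln 2) - p * ((1 / p) / ln 2)
            + ln (1 - p) / ln 2 + (1 - p) * ((1 / (1 - p)) / ln 2) + 2) (at p)"
      using that by (auto intro!: derivative_eq_intros simp: divide_inverse)
    also have "- (ln p / ln 2) - p * ((1 / p) / ln 2)
            + ln (1 - p) / ln 2 + (1 - p) * ((1 / (1 - p)) / ln 2) + 2
          = log 2 (1 - p) - log 2 p + 2"
      using that by (simp add: log_def)
    finally show ?thesis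
      by (simp add: f_def binary_entropy_def log_def)
  qed
  have mono: "f p < f q" if "0 < p" "p < q" "q \<le> 1/2" for p q
  proof (rule DERIV_pos_imp_increasing[OF that(2)])
    fix x assume x: "p \<le> x" "x \<le> q"
    have "log 2 x \<le> log 2 (1 - x)" using x that by simp
    then have "0 < log 2 (1 - x) - log 2 x + 2" by linarith
    moreover have "(f has_real_derivative log 2 (1 - x) - log 2 x + 2) (at x)"
      using x that by (intro deriv) auto
    ultimately show "\<exists>y. (f has_real_derivative y) (at x) \<and> 0 < y" by blast
  qed
  have half: "f (1/2) = 2"
    by (simp add: f_def binary_entropy_def log_divide)
  have "log 2 (1/16 :: real) = -4"
    using log_pow_cancel[of 2 4] by (simp add: log_divide)
  moreover have "- (1/2) \<le> log 2 (15/16 :: real)"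
  proof -
    have "log 2 (1/2 :: real) \<le> log 2 ((15/16) ^ 2)"
      by (subst log_le_cancel_iff) (auto simp: power2_eq_square)
    also have "\<dots> = 2 * log 2 (15/16 :: real)" by (subst log_nat_power) auto
    finally show ?thesis by (simp add: log_divide)
  qed
  ultimately have low: "f (1/16) \<le> 1" by (simp add: f_def binary_entropy_def)
  have cont: "continuous_on {1/16..1/2} f"
    by (rule DERIV_continuous_on, rule has_field_derivative_at_within, rule deriv) auto
  obtain p where p: "1/16 \<le> p" "p \<le> 1/2" "f p = 1"
    using IVT'[OF low _ _ cont] half by auto
  with half have "p < 1/2" by (cases "p = 1/2") auto
  show ?thesis
  proof (rule ex1I[of _ p])
    show "0 \<le> p \<and> p < 1/2 \<and> binary_entropy p = 1 - 2 * p"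
      using p \<open>p < 1/2\<close> by (auto simp: f_def)
  next
    fix q assume q: "0 \<le> q \<and> q < 1/2 \<and> binary_entropy q = 1 - 2 * q"
    then have "q \<noteq> 0" by (auto simp: binary_entropy_def)
    with q have "0 < q" "q \<le> 1/2" "f q = 1" by (auto simp: f_def)
    then show "q = p"
      using mono[of p q] mono[of q p] p by (cases p q rule: linorder_cases) auto
  qed
qed

end

theory Submission
  imports Defs
begin

text \<open>
  Let \<open>M\<close> be a greedy matching of \<open>P_n\<close> and \<open>c\<close> a concept with \<open>|M(c)| = k\<close>. All samples of \<open>c\<close> of
  size below \<open>k\<close> occur as values of \<open>M\<close>, in particular some sample of size \<open>k - 1\<close> is \<open>M(c')\<close> with
  \<open>c' \<noteq> c\<close>. Then all samples of \<open>c'\<close> of size below \<open>k - 1\<close> occur as well, and those containing a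
  point \<open>x\<close> at which \<open>c\<close> and \<open>c'\<close> differ are not samples of \<open>c\<close>. If \<open>k\<close> exceeds \<open>n/2\<close> by a constant
  fraction of \<open>n\<close>, then by Chebyshev's inequality almost all of the \<open>2^n\<close> subsets of the domain have
  size below \<open>k - 1\<close>, so that these two disjoint families have almost \<open>2^n + 2^(n - 1)\<close> members
  together. But \<open>M\<close> has only \<open>2^n\<close> values. Of \<open>p_*\<close> only the inequality \<open>p_* < 1/2\<close> matters.
\<close>

text \<open>For finite \<open>X\<close>, the labeled samples with which \<open>c\<close> is
  consistent are exactly the sets \<open>restricted_sample c A\<close> with
  \<open>A \<subseteq> X\<close>, so counting samples of \<open>c\<close> reduces to counting
  subsets.\<close>

definition restricted_sample :: "'a concept \<Rightarrow> 'a set \<Rightarrow> 'a sample" where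
  "restricted_sample c A = (\<lambda>x. (x, c x)) ` A"

lemma inj_restricted_sample: "inj (restricted_sample c)"
  by (rule injI) (auto simp: restricted_sample_def)

lemma card_restricted_sample [simp]: "card (restricted_sample c A) = card A"
  unfolding restricted_sample_def by (intro card_image inj_onI) auto

lemma consistent_restricted_sample_iff:
  "consistent d (restricted_sample c A) \<longleftrightarrow> (\<forall>x\<in>A. d x = c x)"
  by (auto simp: consistent_def restricted_sample_def)

lemma labeled_sample_restricted_sample:
  "finite X \<Longrightarrow> A \<subseteq> X \<Longrightarrow> labeled_sample X (restricted_sample c A)"
  by (auto simp: labeled_sample_def restricted_sample_def inj_on_def intro: finite_subset)

lemma greedy_matching_smaller_sample_used:
  assumes "greedy_matching X C M" "c \<in> C"
    and "labeled_sample X S" "consistent c S" "card S < card (M c)"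
  shows "S \<in> M ` C"
proof (rule ccontr)
  assume S: "S \<notin> M ` C"
  have M: "saturating_matching X C M"
    using assms(1) by (simp add: greedy_matching_def)
  have "inj_on (M(c := S)) C"
    using M S by (auto simp: saturating_matching_def inj_on_def)
  then have "saturating_matching X C (M(c := S))"
    using M assms(3,4) by (auto simp: saturating_matching_def)
  then have "direct_improvement X C M (M(c := S))"
    using M assms(2,5) by (auto simp: direct_improvement_def)
  with assms(1) show False by (auto simp: greedy_matching_def)
qed

text \<open>Variance of a sum of \<open>card X\<close> independent random signs, scaled by the
  number of subsets: membership of a point in \<open>A\<close> contributes +1, absence -1.\<close>

lemma sum_Pow_square_deviation:
  assumes "finite X"
  shows "(\<Sum>A\<in>Pow X. (2 * real (card A) - real (card X))\<^sup>2) = real (card X) * 2 ^ card X"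
  using assms
proof (induction X)
  case (insert x X)
  have inj: "inj_on (insert x) (Pow X)"
    using insert.hyps(2) by (auto simp: inj_on_def)
  have disj: "Pow X \<inter> insert x ` Pow X = {}"
    using insert.hyps(2) by auto
  have card_ins: "card (insert x A) = Suc (card A)" if "A \<in> Pow X" for A
    using that insert.hyps by (intro card_insert_disjoint) (auto intro: finite_subset)
  have "(\<Sum>A\<in>Pow (insert x X). (2 * real (card A) - real (card (insert x X)))\<^sup>2)
      = (\<Sum>A\<in>Pow X. (2 * real (card A) - (real (card X) + 1))\<^sup>2)
        + (\<Sum>A\<in>Pow X. (2 * real (card (insert x A)) - (real (card X) + 1))\<^sup>2)"
    using insert.hyps inj disj
    by (simp add: Pow_insert sum.union_disjoint sum.reindex add.commute)
  also have "\<dots> = (\<Sum>A\<in>Pow X. (2 * real (card A) - (real (card X) + 1))\<^sup>2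
        + (2 * real (Suc (card A)) - (real (card X) + 1))\<^sup>2)"
    by (simp add: sum.distrib card_ins del: of_nat_Suc)
  \<comment> \<open>With t the deviation of \<open>A\<close> within \<open>X\<close>, the two
    summands are (t - 1)^2 and (t + 1)^2.\<close>
  also have "\<dots> = (\<Sum>A\<in>Pow X. 2 * (2 * real (card A) - real (card X))\<^sup>2 + 2)"
    by (intro sum.cong refl) (simp add: power2_eq_square algebra_simps)
  also have "\<dots> = 2 * (real (card X) * 2 ^ card X) + 2 * 2 ^ card X"
    using insert.hyps(1) by (simp add: sum.distrib insert.IH card_Pow flip: sum_distrib_left)
  finally show ?case
    using insert.hyps by (simp add: algebra_simps)
qed simp

text \<open>One-sided Chebyshev inequality. The assumption \<open>card X \<le> 2 * j\<close> makes
  the deviation nonnegative, so that squaring preserves the order.\<close>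

lemma card_large_subsets_le:
  assumes "finite X" "card X \<le> 2 * j"
  shows "real (card {A. A \<subseteq> X \<and> j \<le> card A}) * (2 * real j - real (card X))\<^sup>2
    \<le> real (card X) * 2 ^ card X"
proof -
  let ?L = "{A. A \<subseteq> X \<and> j \<le> card A}"
  have "real (card ?L) * (2 * real j - real (card X))\<^sup>2
      = (\<Sum>A\<in>?L. (2 * real j - real (card X))\<^sup>2)"
    by simp
  also have "\<dots> \<le> (\<Sum>A\<in>?L. (2 * real (card A) - real (card X))\<^sup>2)"
    using assms(2) by (intro sum_mono power_mono) auto
  also have "\<dots> \<le> (\<Sum>A\<in>Pow X. (2 * real (card A) - real (card X))\<^sup>2)"
    using assms(1) by (intro sum_mono2) auto
  finally show ?thesis
    using sum_Pow_square_deviation[OF assms(1)] by simp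
qed

lemma card_powerset_class: "finite X \<Longrightarrow> card (powerset_class X) = 2 ^ card X"
  by (simp add: powerset_class_def card_PiE)

lemma finite_powerset_class: "finite X \<Longrightarrow> finite (powerset_class X)"
  by (simp add: powerset_class_def finite_PiE)

lemma powerset_class_nonempty: "powerset_class X \<noteq> {}"
  by (simp add: powerset_class_def PiE_eq_empty_iff)

lemma card_le_card_filter_less_add:
  "card F \<le> card {A \<in> F. card A < j} + card {A \<in> F. j \<le> card A}"
proof -
  have "F = {A \<in> F. card A < j} \<union> {A \<in> F. j \<le> card A}" by auto
  then show ?thesis by (metis card_Un_le)
qed

text \<open>With n = \<open>card X\<close> and L the number of large subsets, the two disjoint
  families have at least 2^n - L and 2^(n - 1) - L members, and together at most 2^n.\<close>

lemma greedy_matching_powerset_class_bound: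
  assumes X: "finite X" and M: "greedy_matching X (powerset_class X) M"
    and c: "c \<in> powerset_class X" and k: "card (M c) = Suc k"
  shows "2 ^ card X \<le> 4 * card {A. A \<subseteq> X \<and> k \<le> card A}"
proof -
  let ?C = "powerset_class X"
  let ?L = "{A. A \<subseteq> X \<and> k \<le> card A}"
  have sat: "saturating_matching X ?C M"
    using M by (simp add: greedy_matching_def)
  have "k \<le> card X"
    using saturating_matching_card_le[OF X sat c] k by simp
  then obtain B where B: "B \<subseteq> X" "card B = k"
    by (meson obtain_subset_with_card_n)
  have used: "restricted_sample d A \<in> M ` ?C"
    if "d \<in> ?C" "A \<subseteq> X" "card A < card (M d)" for d A
    using that by (intro greedy_matching_smaller_sample_used[OF M])
      (auto simp: labeled_sample_restricted_sample[OF X] consistent_restricted_sample_iff)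
  obtain d where d: "d \<in> ?C" "M d = restricted_sample c B"
    using used[OF c B(1)] B k by auto
  then have card_d: "card (M d) = k" using B by simp
  then have "d \<noteq> c" using k by auto
  then obtain x where x: "x \<in> X" "c x \<noteq> d x"
    using c d(1) by (auto simp: powerset_class_def dest: PiE_ext)
  define F1 where "F1 = {A \<in> Pow X. card A < k}"
  \<comment> \<open>The sets \<open>insert x A\<close> with \<open>A \<subseteq> X - {x}\<close> are
    the 2^(n - 1) subsets of \<open>X\<close> that contain \<open>x\<close>.\<close>
  define F2 where "F2 = {A \<in> insert x ` Pow (X - {x}). card A < k}"
  have sub: "restricted_sample c ` F1 \<union> restricted_sample d ` F2 \<subseteq> M ` ?C"
    using c d(1) k card_d x by (auto simp: F1_def F2_def intro!: used)
  have disj: "restricted_sample c ` F1 \<inter> restricted_sample d ` F2 = {}"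
  proof -
    \<comment> \<open>The left sample is consistent with \<open>c\<close>; the right one labels
      \<open>x\<close> by \<open>d x\<close>, so it is not.\<close>
    have "restricted_sample c A \<noteq> restricted_sample d A'" if "x \<in> A'" for A A'
      using that x consistent_restricted_sample_iff[of c c A]
        consistent_restricted_sample_iff[of c d A'] by metis
    then show ?thesis by (auto simp: F2_def)
  qed
  have fin: "finite F1" "finite F2"
    using X by (auto simp: F1_def F2_def)
  have "card F1 + card F2 = card (restricted_sample c ` F1 \<union> restricted_sample d ` F2)"
    using fin disj by (simp add: card_Un_disjoint card_image inj_on_subset[OF inj_restricted_sample])
  also have "\<dots> \<le> card (M ` ?C)"
    using sub X by (intro card_mono) (auto simp: finite_powerset_class)
  also have "\<dots> \<le> 2 ^ card X"
    using card_image_le[OF finite_powerset_class[OF X], of M] card_powerset_class[OF X] by simp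
  finally have upper: "card F1 + card F2 \<le> 2 ^ card X" .
  have finL: "finite ?L" using X by simp
  have "card (Pow X) \<le> card F1 + card {A \<in> Pow X. k \<le> card A}"
    unfolding F1_def by (rule card_le_card_filter_less_add)
  then have lower1: "2 ^ card X \<le> card F1 + card ?L"
    using X by (simp add: card_Pow)
  have "card (insert x ` Pow (X - {x})) \<le> card F2 + card {A \<in> insert x ` Pow (X - {x}). k \<le> card A}"
    unfolding F2_def by (rule card_le_card_filter_less_add)
  also have "\<dots> \<le> card F2 + card ?L"
    using x by (intro add_left_mono card_mono[OF finL]) auto
  also have "card (insert x ` Pow (X - {x})) = 2 ^ (card X - 1)"
    using X x by (subst card_image) (auto simp: inj_on_def card_Pow)
  finally have lower2: "2 ^ (card X - 1) \<le> card F2 + card ?L" .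
  have "(2::nat) ^ card X = 2 * 2 ^ (card X - 1)"
    using X x by (cases "card X") auto
  with upper lower1 lower2 show ?thesis by linarith
qed

text \<open>Both maxima, over greedy matchings and over concepts, range over finite nonempty
  sets.\<close>

lemma GMN_attained:
  assumes "finite X" "finite C" "C \<noteq> {}" "C \<subseteq> X \<rightarrow>\<^sub>E UNIV"
  obtains M c where "greedy_matching X C M" "c \<in> C" "card (M c) = GMN X C"
proof -
  have "GMN X C \<in> {cost C M | M. greedy_matching X C M}"
    unfolding GMN_def using finite_greedy_costs[OF assms(1-3)]
      greedy_matching_exists[OF assms(1,2,4)] by (intro Max_in) auto
  then obtain M where M: "greedy_matching X C M" "GMN X C = cost C M" by auto
  have "cost C M \<in> (\<lambda>c. card (M c)) ` C"
    unfolding cost_def using assms by (intro Max_in) auto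
  with M that show ?thesis by (metis imageE)
qed

text \<open>Write \<delta> = 1 - 2p and n = \<open>card X\<close>. A larger cost would force a
  deviation of at least \<delta>n/2, whose square Chebyshev's inequality bounds by 4n; hence n would
  be at most 16/\<delta>^2.\<close>

lemma GMN_powerset_class_le:
  assumes X: "finite X" and p: "0 < p" "p < 1/2"
    and large: "16 / (1 - 2 * p)\<^sup>2 < real (card X)"
  shows "real (GMN X (powerset_class X)) \<le> (1 - p) * real (card X)"
proof (rule ccontr)
  define n where "n = real (card X)"
  define \<delta> where "\<delta> = 1 - 2 * p"
  have \<delta>: "0 < \<delta>" "\<delta> \<le> 1" using p by (auto simp: \<delta>_def)
  have \<delta>2n: "16 < \<delta>\<^sup>2 * n"
    using large \<delta> by (simp add: \<delta>_def n_def divide_less_eq mult.commute)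
  have n: "0 < n" unfolding n_def by (rule le_less_trans[OF _ large]) simp
  have "\<delta>\<^sup>2 * n \<le> \<delta> * n"
    using \<delta> n by (intro mult_right_mono) (auto simp: power2_eq_square mult_left_le)
  with \<delta>2n have \<delta>n: "16 < \<delta> * n" by linarith
  assume "\<not> real (GMN X (powerset_class X)) \<le> (1 - p) * real (card X)"
  then have big: "(1 - p) * n < real (GMN X (powerset_class X))" by (simp add: n_def)
  obtain M c where M: "greedy_matching X (powerset_class X) M" "c \<in> powerset_class X"
    "card (M c) = GMN X (powerset_class X)"
    using GMN_attained[of X "powerset_class X"] X finite_powerset_class[OF X]
      powerset_class_nonempty[of X] by (auto simp: powerset_class_def)
  have "0 < (1 - p) * n" using p n by simp
  with big obtain k where k: "GMN X (powerset_class X) = Suc k"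
    by (cases "GMN X (powerset_class X)") auto
  define L where "L = card {A. A \<subseteq> X \<and> k \<le> card A}"
  \<comment> \<open>From k + 1 > (1 - p)n one gets 2k - n > \<delta>n - 2; the loss of 2 is absorbed
    by half of \<delta>n > 16.\<close>
  have dev: "\<delta> * n / 2 \<le> 2 * real k - n"
  proof -
    have "(1 - p) * n = (n + \<delta> * n) / 2" by (simp add: \<delta>_def algebra_simps)
    with big \<delta>n show ?thesis by (simp add: k)
  qed
  have "card X \<le> 2 * k"
    using dev \<delta>n by (simp add: n_def)
  then have "real L * (2 * real k - n)\<^sup>2 \<le> n * 2 ^ card X"
    unfolding L_def n_def by (rule card_large_subsets_le[OF X])
  moreover have "2 ^ card X \<le> 4 * L"
    unfolding L_def using greedy_matching_powerset_class_bound[OF X M(1,2)] M(3) k by simp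
  then have "2 ^ card X \<le> 4 * real L"
    by (metis of_nat_le_iff of_nat_mult of_nat_numeral of_nat_power)
  then have "2 ^ card X * (2 * real k - n)\<^sup>2 \<le> 4 * real L * (2 * real k - n)\<^sup>2"
    by (intro mult_right_mono) auto
  ultimately have "2 ^ card X * (2 * real k - n)\<^sup>2 \<le> 4 * (n * 2 ^ card X)"
    by linarith
  also have "\<dots> = 2 ^ card X * (4 * n)" by simp
  finally have "(2 * real k - n)\<^sup>2 \<le> 4 * n"
    by (rule mult_left_le_imp_le) simp
  moreover have "(\<delta> * n / 2)\<^sup>2 \<le> (2 * real k - n)\<^sup>2"
    using dev \<delta>n by (intro power_mono) auto
  moreover have "(\<delta> * n / 2)\<^sup>2 = \<delta>\<^sup>2 * n * n / 4"
    by (simp add: power2_eq_square)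
  moreover have "16 * n < \<delta>\<^sup>2 * n * n"
    using \<delta>2n n by (intro mult_strict_right_mono)
  ultimately show False by linarith
qed

theorem theorem6p2:
  fixes p0 :: real
  assumes "0 < p0" and "p0 < p_star"
  shows "finite {n :: nat. 0 < n \<and>
           \<not> (\<forall>X :: 'a set. finite X \<and> card X = n \<longrightarrow>
                 int (GMN X (powerset_class X)) \<le> \<lceil>(1 - p0) * real n\<rceil>)}"
proof (rule finite_subset)
  have "p_star < 1/2"
    unfolding p_star_def using theI'[OF p_star_ex1] by simp
  then have p: "0 < p0" "p0 < 1/2" using assms by auto
  \<comment> \<open>Rounding down is harmless: an integer above the floor of the threshold exceeds
    the threshold itself.\<close>
  let ?N = "nat \<lfloor>16 / (1 - 2 * p0)\<^sup>2\<rfloor>"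
  show "{n :: nat. 0 < n \<and>
           \<not> (\<forall>X :: 'a set. finite X \<and> card X = n \<longrightarrow>
                 int (GMN X (powerset_class X)) \<le> \<lceil>(1 - p0) * real n\<rceil>)} \<subseteq> {..?N}"
  proof (rule subsetI, rule ccontr)
    fix n
    assume "n \<in> {n :: nat. 0 < n \<and>
           \<not> (\<forall>X :: 'a set. finite X \<and> card X = n \<longrightarrow>
                 int (GMN X (powerset_class X)) \<le> \<lceil>(1 - p0) * real n\<rceil>)}"
    then obtain X :: "'a set" where X: "finite X" "card X = n"
      "\<not> int (GMN X (powerset_class X)) \<le> \<lceil>(1 - p0) * real n\<rceil>"
      by auto
    assume "n \<notin> {..?N}"
    then have "16 / (1 - 2 * p0)\<^sup>2 < real (card X)"
      using X(2) by simp linarith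
    from GMN_powerset_class_le[OF X(1) p this] X(2)
    have "real_of_int (int (GMN X (powerset_class X))) \<le> real_of_int \<lceil>(1 - p0) * real n\<rceil>"
      by (simp add: order_trans[OF _ le_of_int_ceiling])
    with X(3) show False by linarith
  qed
qed simp

end
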